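(* Let $A>0$. Then $\mathrm{Isom}(\overline{\mathfrak{AT}_A})=S_3$. That is, the isometries of $(\overline{\mathfrak{AT}_A},m)$ are exactly the maps $(a_1,a_2,a_3)\mapsto(a_{\sigma(1)},a_{\sigma(2)},a_{\sigma(3)})$, $\sigma\in S_3$ (where $(a_1,a_2,a_3)$ are the edge lengths of a triangle), and the isometry group is isomorphic to $S_3$, the group of permutations of $\{1,2,3\}$.
   Context: A labeled triangle is a (non-degenerate) Euclidean triangle with vertices labeled $v_1,v_2,v_3$ in counter-clockwise order. $\overline{\mathfrak{AT}_A}$ denotes the set of labeled non-obtuse triangles (all angles $\le\pi/2$) of area $A$, modulo label-respecting isometry. Each element is identified with the triple $(a_1,a_2,a_3)$ of its edge lengths, $a_i$ being the length of the edge opposite $v_i$. The metric is $$m\big((a_1,a_2,a_3),(a_1',a_2',a_3')\big)=\max_i|\log a_i'-\log a_i|.$$ $\mathrm{Isom}(\overline{\mathfrak{AT}_A})$ is the group of isometries (distance-preserving bijections) of $(\overline{\mathfrak{AT}_A},m)$. A permutation $\sigma\in S_3$ is identified with the isometry $(a_1,a_2,a_3)\mapsto(a_{\sigma(1)},a_{\sigma(2)},a_{\sigma(3)})$. *)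

theory Defs
  imports "HOL-Analysis.Analysis" "HOL-Algebra.Bij" "HOL-Algebra.Sym_Groups"
begin

text \<open>
  Triples, both of points and of edge lengths, are functions on the labels \<open>{1..3}\<close>.
  They are kept extensional so that equality of triples is equality of functions.
\<close>

definition next_label :: "nat \<Rightarrow> nat"
  where "next_label i = i mod 3 + 1"

lemma next_label_simps [simp]:
  "next_label 1 = 2" "next_label (Suc 0) = 2" "next_label 2 = 3" "next_label 3 = 1"
  by (simp_all add: next_label_def)

lemma labels_eq: "{1..3::nat} = {1, 2, 3}"
  by auto

definition vangle :: "'a::real_inner \<Rightarrow> 'a \<Rightarrow> real"
  where "vangle x y = arccos ((x \<bullet> y) / (norm x * norm y))"

text \<open>Strict positivity of the determinant is both non-degeneracy and counter-clockwise order.\<close>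

definition labeled_triangle :: "(nat \<Rightarrow> real^2) \<Rightarrow> bool"
  where "labeled_triangle v \<longleftrightarrow>
    v \<in> extensional {1..3} \<and> det (vector [v 2 - v 1, v 3 - v 1] :: real^2^2) > 0"

definition triangle_angle :: "(nat \<Rightarrow> real^2) \<Rightarrow> nat \<Rightarrow> real"
  where "triangle_angle v i =
    vangle (v (next_label i) - v i) (v (next_label (next_label i)) - v i)"

definition triangle_area :: "(nat \<Rightarrow> real^2) \<Rightarrow> real"
  where "triangle_area v = measure lborel (convex hull (v ` {1..3}))"

definition edge_lengths :: "(nat \<Rightarrow> real^2) \<Rightarrow> nat \<Rightarrow> real"
  where "edge_lengths v =
    (\<lambda>i\<in>{1..3}. dist (v (next_label i)) (v (next_label (next_label i))))"

text \<open>
  The congruence class of a labeled triangle is represented by its triple of edge lengths;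
  \<open>edge_lengths_eq_iff_congruent\<close> below justifies this.
\<close>

definition AT_bar :: "real \<Rightarrow> (nat \<Rightarrow> real) set"
  where "AT_bar A = edge_lengths ` {v. labeled_triangle v \<and>
    (\<forall>i\<in>{1..3}. triangle_angle v i \<le> pi / 2) \<and> triangle_area v = A}"

definition mdist_AT :: "(nat \<Rightarrow> real) \<Rightarrow> (nat \<Rightarrow> real) \<Rightarrow> real"
  where "mdist_AT a a' = (MAX i\<in>{1..3}. \<bar>ln (a' i) - ln (a i)\<bar>)"

text \<open>As in \<^const>\<open>BijGroup\<close>, maps are extensional on \<open>X\<close>.\<close>

definition isometry_group :: "'a set \<Rightarrow> ('a \<Rightarrow> 'a \<Rightarrow> real) \<Rightarrow> ('a \<Rightarrow> 'a) monoid"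
  where "isometry_group X d =
    (BijGroup X)\<lparr>carrier := {f \<in> Bij X. \<forall>x\<in>X. \<forall>y\<in>X. d (f x) (f y) = d x y}\<rparr>"

definition Isom_AT :: "real \<Rightarrow> ((nat \<Rightarrow> real) \<Rightarrow> (nat \<Rightarrow> real)) monoid"
  where "Isom_AT A = isometry_group (AT_bar A) mdist_AT"

definition permute_edges :: "real \<Rightarrow> (nat \<Rightarrow> nat) \<Rightarrow> (nat \<Rightarrow> real) \<Rightarrow> (nat \<Rightarrow> real)"
  where "permute_edges A \<sigma> = (\<lambda>a\<in>AT_bar A. \<lambda>i\<in>{1..3}. a (\<sigma> i))"


lemma edge_lengths_simps:
  "edge_lengths v 1 = dist (v 2) (v 3)"
  "edge_lengths v 2 = dist (v 3) (v 1)"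
  "edge_lengths v 3 = dist (v 1) (v 2)"
  by (simp_all add: edge_lengths_def)

lemma det_edges:
  "det (vector [p, q] :: real^2^2) = p $ 1 * q $ 2 - p $ 2 * q $ 1"
  by (simp add: det_2 vector_def)

lemma triangle_area_eq_det:
  assumes "labeled_triangle v"
  shows "triangle_area v = det (vector [v 2 - v 1, v 3 - v 1] :: real^2^2) / 2"
proof -
  have "v ` {1..3} = {v 1, v 2, v 3}" unfolding labels_eq by simp
  then show ?thesis
    using assms unfolding triangle_area_def labeled_triangle_def
    by (simp add: content_triangle det_edges abs_if algebra_simps)
qed

lemma edge_lengths_eq_iff_congruent:
  assumes v: "labeled_triangle v" and w: "labeled_triangle w"
  shows "edge_lengths v = edge_lengths w \<longleftrightarrow>
    (\<exists>f :: real^2 \<Rightarrow> real^2. (\<forall>x y. dist (f x) (f y) = dist x y) \<and> (\<forall>i\<in>{1..3}. f (v i) = w i))"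
proof
  assume "\<exists>f :: real^2 \<Rightarrow> real^2. (\<forall>x y. dist (f x) (f y) = dist x y) \<and> (\<forall>i\<in>{1..3}. f (v i) = w i)"
  then obtain f where f: "\<And>x y. dist (f x) (f y) = dist x y" "\<And>i. i \<in> {1..3} \<Longrightarrow> f (v i) = w i"
    by metis
  have "dist (v i) (v j) = dist (w i) (w j)" if "i \<in> {1..3}" "j \<in> {1..3}" for i j
    using f that by metis
  then show "edge_lengths v = edge_lengths w"
    by (auto simp: edge_lengths_def restrict_def fun_eq_iff next_label_def)
next
  assume eq: "edge_lengths v = edge_lengths w"
  define p where "p = v 2 - v 1"
  define u where "u = v 3 - v 1"
  define q where "q = w 2 - w 1"
  define x where "x = w 3 - w 1"
  have dp: "p $ 1 * u $ 2 - p $ 2 * u $ 1 > 0" and dq: "q $ 1 * x $ 2 - q $ 2 * x $ 1 > 0"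
    using v w by (auto simp: labeled_triangle_def det_edges p_def u_def q_def x_def)
  have n1: "p \<bullet> p = q \<bullet> q" using arg_cong[OF eq, of "\<lambda>a. a 3"]
    by (simp add: edge_lengths_simps dist_norm norm_eq_sqrt_inner p_def q_def norm_minus_commute inner_diff algebra_simps)
  have n2: "u \<bullet> u = x \<bullet> x" using arg_cong[OF eq, of "\<lambda>a. a 2"]
    by (simp add: edge_lengths_simps dist_norm norm_eq_sqrt_inner u_def x_def)
  have "(u - p) \<bullet> (u - p) = (x - q) \<bullet> (x - q)" using arg_cong[OF eq, of "\<lambda>a. a 1"]
    unfolding edge_lengths_simps
    by (simp add: dist_norm norm_eq_sqrt_inner u_def x_def p_def q_def inner_diff algebra_simps inner_commute)
  then have n3: "p \<bullet> u = q \<bullet> x" using n1 n2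
    by (simp add: inner_diff inner_commute)
  have "(p $ 1 * u $ 2 - p $ 2 * u $ 1)\<^sup>2 = (p \<bullet> p) * (u \<bullet> u) - (p \<bullet> u)\<^sup>2"
    by (simp add: inner_vec_def sum_2 power2_eq_square algebra_simps)
  also have "\<dots> = (q $ 1 * x $ 2 - q $ 2 * x $ 1)\<^sup>2"
    unfolding n1 n2 n3 by (simp add: inner_vec_def sum_2 power2_eq_square algebra_simps)
  finally have n4: "p $ 1 * u $ 2 - p $ 2 * u $ 1 = q $ 1 * x $ 2 - q $ 2 * x $ 1"
    using dp dq by (simp add: power2_eq_iff)
  define N where "N = p \<bullet> p"
  have "p \<noteq> 0" using dp by auto
  then have N: "N > 0" by (simp add: N_def)
  define c where "c = (p \<bullet> q) / N"
  define s where "s = (p $ 1 * q $ 2 - p $ 2 * q $ 1) / N"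
  have cN: "c * N = p $ 1 * q $ 1 + p $ 2 * q $ 2" and sN: "s * N = p $ 1 * q $ 2 - p $ 2 * q $ 1"
    using N by (simp_all add: c_def s_def inner_vec_def sum_2)
  have "(c * N)\<^sup>2 + (s * N)\<^sup>2 = (p \<bullet> p) * (q \<bullet> q)"
    unfolding cN sN by (simp add: inner_vec_def sum_2 power2_eq_square algebra_simps)
  then have "(c\<^sup>2 + s\<^sup>2) * N\<^sup>2 = 1 * N\<^sup>2"
    using n1 by (simp add: N_def power2_eq_square algebra_simps)
  then have cs: "c\<^sup>2 + s\<^sup>2 = 1" using N by simp
  define R :: "real^2 \<Rightarrow> real^2" where "R = (\<lambda>y. vector [c * y $ 1 - s * y $ 2, s * y $ 1 + c * y $ 2])"
  have R1: "R y $ 1 = c * y $ 1 - s * y $ 2" and R2: "R y $ 2 = s * y $ 1 + c * y $ 2" for y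
    by (simp_all add: R_def)
  have Rdiff: "R y - R z = R (y - z)" for y z
    by (simp add: vec_eq_iff forall_2 R1 R2 algebra_simps)
  have "R y \<bullet> R y = (c\<^sup>2 + s\<^sup>2) * (y \<bullet> y)" for y
    by (simp add: inner_vec_def sum_2 R1 R2 power2_eq_square algebra_simps)
  then have Rnorm: "norm (R y) = norm y" for y
    by (simp add: norm_eq_sqrt_inner cs)
  have q': "p $ 1 * p $ 1 + p $ 2 * p $ 2 = N" "q $ 1 * q $ 1 + q $ 2 * q $ 2 = N"
    using n1 by (simp_all add: N_def inner_vec_def sum_2)
  have d: "p $ 1 * u $ 1 + p $ 2 * u $ 2 = q $ 1 * x $ 1 + q $ 2 * x $ 2"
    using n3 by (simp add: inner_vec_def sum_2)
  have "N * R p $ 1 = N * q $ 1" "N * R p $ 2 = N * q $ 2"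
    unfolding R1 R2 using cN sN q' by algebra+
  then have Rp: "R p = q" using N by (simp add: vec_eq_iff forall_2)
  have "N * R u $ 1 = N * x $ 1" "N * R u $ 2 = N * x $ 2"
    unfolding R1 R2 using cN sN q' d n4 by algebra+
  then have Ru: "R u = x" using N by (simp add: vec_eq_iff forall_2)
  have R0: "R 0 = 0" by (simp add: vec_eq_iff forall_2 R1 R2)
  define f where "f = (\<lambda>y. w 1 + R (y - v 1))"
  have "dist (f y) (f z) = dist y z" for y z
    by (simp add: f_def dist_norm Rdiff Rnorm)
  moreover have "f (v i) = w i" if "i \<in> {1..3}" for i
    using that Rp Ru R0 unfolding labels_eq by (auto simp: f_def p_def u_def q_def x_def)
  ultimately show "\<exists>f :: real^2 \<Rightarrow> real^2. (\<forall>x y. dist (f x) (f y) = dist x y) \<and> (\<forall>i\<in>{1..3}. f (v i) = w i)"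
    by blast
qed

lemma AT_bar_extensional: "a \<in> AT_bar A \<Longrightarrow> a \<in> extensional {1..3}"
  by (auto simp: AT_bar_def edge_lengths_def)

lemma AT_bar_pos:
  assumes "a \<in> AT_bar A" "i \<in> {1..3}"
  shows "a i > 0"
proof -
  obtain v where v: "labeled_triangle v" "a = edge_lengths v"
    using assms by (auto simp: AT_bar_def)
  have "v 2 \<noteq> v 3" "v 3 \<noteq> v 1" "v 1 \<noteq> v 2"
    using v(1) by (auto simp: labeled_triangle_def det_edges)
  then show ?thesis
    using assms(2) v(2) unfolding labels_eq by (auto simp: edge_lengths_simps simp del: One_nat_def)
qed

lemma mdist_AT_eq:
  "mdist_AT a b = max \<bar>ln (b 1) - ln (a 1)\<bar> (max \<bar>ln (b 2) - ln (a 2)\<bar> \<bar>ln (b 3) - ln (a 3)\<bar>)"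
  unfolding mdist_AT_def labels_eq by simp

lemma Metric_space_AT: "Metric_space (AT_bar A) mdist_AT"
proof
  show "0 \<le> mdist_AT a b" for a b by (auto simp: mdist_AT_eq)
  show "mdist_AT a b = mdist_AT b a" for a b by (simp add: mdist_AT_eq abs_minus_commute)
  show "mdist_AT a c \<le> mdist_AT a b + mdist_AT b c" for a b c
  proof -
    have "\<bar>ln (c i) - ln (a i)\<bar> \<le> mdist_AT a b + mdist_AT b c" if "i \<in> {1..3}" for i
    proof -
      have "\<bar>ln (b i) - ln (a i)\<bar> \<le> mdist_AT a b" "\<bar>ln (c i) - ln (b i)\<bar> \<le> mdist_AT b c"
        unfolding mdist_AT_def using that by (intro Max_ge; simp)+
      then show ?thesis by linarith
    qed
    then show ?thesis unfolding mdist_AT_def[of a c] by (subst Max_le_iff) auto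
  qed
  show "mdist_AT a b = 0 \<longleftrightarrow> a = b" if a: "a \<in> AT_bar A" and b: "b \<in> AT_bar A" for a b
  proof
    assume "mdist_AT a b = 0"
    then have "ln (b 1) = ln (a 1)" "ln (b 2) = ln (a 2)" "ln (b 3) = ln (a 3)"
      by (auto simp: mdist_AT_eq max_def split: if_splits)
    then have "a i = b i" if "i \<in> {1..3}" for i
      using that AT_bar_pos[OF a] AT_bar_pos[OF b] unfolding labels_eq by (auto simp del: One_nat_def)
    then show "a = b"
      using AT_bar_extensional[OF a] AT_bar_extensional[OF b] by (meson extensionalityI)
  qed (simp add: mdist_AT_eq)
qed

lemma group_isometry_group: "group (isometry_group X d)"
proof -
  let ?H = "{f \<in> Bij X. \<forall>x\<in>X. \<forall>y\<in>X. d (f x) (f y) = d x y}"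
  interpret group "BijGroup X" by (rule group_BijGroup)
  have "subgroup ?H (BijGroup X)"
  proof (rule subgroupI)
    show "?H \<subseteq> carrier (BijGroup X)" by (auto simp: BijGroup_def)
    show "?H \<noteq> {}" using id_Bij[of X] by (auto intro!: exI[of _ "\<lambda>x\<in>X. x"])
    show "inv\<^bsub>BijGroup X\<^esub> f \<in> ?H" if f: "f \<in> ?H" for f
    proof -
      have bij: "bij_betw f X X" using f by (auto simp: Bij_def)
      have "d (inv_into X f x) (inv_into X f y) = d x y" if "x \<in> X" "y \<in> X" for x y
      proof -
        have "inv_into X f x \<in> X" "inv_into X f y \<in> X"
          using bij that by (auto simp: bij_betw_def intro: inv_into_into)
        then have "d (f (inv_into X f x)) (f (inv_into X f y)) = d (inv_into X f x) (inv_into X f y)"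
          using f by auto
        then show ?thesis using bij that by (simp add: bij_betw_inv_into_right)
      qed
      then show ?thesis using f restrict_inv_into_Bij[of f X] by (simp add: inv_BijGroup)
    qed
    show "f \<otimes>\<^bsub>BijGroup X\<^esub> g \<in> ?H" if "f \<in> ?H" "g \<in> ?H" for f g
      using that Bij_imp_funcset[of g X]
      by (auto simp: BijGroup_def compose_Bij compose_eq Pi_iff)
  qed
  then show ?thesis
    unfolding isometry_group_def by (rule subgroup.subgroup_is_group) (rule group_BijGroup)
qed

end

theory Submission
  imports Defs "HOL-Real_Asymp.Real_Asymp"
begin

text \<open>
  Write \<open>y\<^sub>i = ln a\<^sub>i\<close>, so that the metric is the sup metric in the coordinates \<open>y\<close>. In a
  non-obtuse triangle of area \<open>A\<close> any two edges satisfy \<open>2 A \<le> a\<^sub>i a\<^sub>j\<close>, with equality exactly at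
  a right angle. The space has three ends, given by \<open>a\<^sub>k \<rightarrow> 0\<close>, and there
  \<open>a\<^sub>k a\<^sub>j \<rightarrow> 2 A\<close> for both \<open>j \<noteq> k\<close>. Together these facts make \<open>y\<^sub>k\<close> the Busemann
  function of the \<open>k\<close>-th end. An isometry sends ends to ends, hence it permutes the \<open>y\<^sub>i\<close> up to
  additive constants \<open>b\<^sub>i\<close>. Since the minimum \<open>ln (2 A)\<close> of \<open>y\<^sub>i + y\<^sub>j\<close> is attained and has to be
  preserved, \<open>b\<^sub>i + b\<^sub>j = 0\<close> for all \<open>i \<noteq> j\<close>, so all constants vanish.
\<close>

section \<open>Conway symbols as coordinates on the space\<close>

text \<open>
  The parameters \<open>p\<^sub>i = a\<^sub>j a\<^sub>k cos \<alpha>\<^sub>i\<close>, where \<open>{i, j, k} = {1, 2, 3}\<close> and \<open>\<alpha>\<^sub>i\<close> is the angle at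
  \<open>v\<^sub>i\<close>: then \<open>a\<^sub>i\<^sup>2 = p\<^sub>j + p\<^sub>k\<close>, a triangle is non-obtuse iff all \<open>p\<^sub>i\<close> are nonnegative, and the
  quadratic equation is Heron's formula.
\<close>

definition conway_symbols :: "real \<Rightarrow> (nat \<Rightarrow> real) set"
  where "conway_symbols A =
    {p. (\<forall>i\<in>{1..3}. 0 \<le> p i) \<and> p 1 * p 2 + p 2 * p 3 + p 3 * p 1 = 4 * A\<^sup>2}"

definition edges_of_conway :: "(nat \<Rightarrow> real) \<Rightarrow> nat \<Rightarrow> real"
  where "edges_of_conway p = (\<lambda>i\<in>{1..3}. sqrt (p 1 + p 2 + p 3 - p i))"

lemma vangle_le_pi_half_iff:
  assumes "x \<noteq> 0" "y \<noteq> 0"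
  shows "vangle x y \<le> pi / 2 \<longleftrightarrow> 0 \<le> x \<bullet> y"
proof -
  let ?c = "(x \<bullet> y) / (norm x * norm y)"
  have c: "\<bar>?c\<bar> \<le> 1"
    using assms Cauchy_Schwarz_ineq2[of x y] by (simp add: abs_mult)
  have "arccos ?c \<le> arccos 0 \<longleftrightarrow> 0 \<le> ?c"
    using c by (intro arccos_le_mono) auto
  moreover have "norm x * norm y > 0" using assms by simp
  ultimately show ?thesis
    by (simp add: vangle_def zero_le_divide_iff)
qed

text \<open>The symbols of a triangle are the dot products of the two edge vectors leaving each
  vertex, and an angle is at most \<open>pi / 2\<close> iff its dot product is nonnegative.
  Conversely, symbols determine explicit vertices in the plane.\<close>

lemma AT_bar_eq_conway:
  assumes "A > 0"
  shows "AT_bar A = edges_of_conway ` conway_symbols A"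
proof (intro equalityI subsetI)
  fix a assume "a \<in> AT_bar A"
  then obtain v where v: "labeled_triangle v" "a = edge_lengths v" "triangle_area v = A"
    and angle: "\<And>i. i \<in> {1..3} \<Longrightarrow> triangle_angle v i \<le> pi / 2"
    by (auto simp: AT_bar_def)
  define p where "p i = (v (next_label i) - v i) \<bullet> (v (next_label (next_label i)) - v i)" for i
  have p: "p 1 = (v 2 - v 1) \<bullet> (v 3 - v 1)" "p 2 = (v 3 - v 2) \<bullet> (v 1 - v 2)"
    "p 3 = (v 1 - v 3) \<bullet> (v 2 - v 3)"
    by (simp_all add: p_def)
  have det: "det (vector [v 2 - v 1, v 3 - v 1] :: real^2^2) = 2 * A"
    using triangle_area_eq_det[OF v(1)] v(3) by simp
  have "v 2 \<noteq> v 3" "v 3 \<noteq> v 1" "v 1 \<noteq> v 2"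
    using v(1) by (auto simp: labeled_triangle_def det_edges)
  then have nz: "v (next_label i) - v i \<noteq> 0 \<and> v (next_label (next_label i)) - v i \<noteq> 0"
    if "i \<in> {1..3}" for i
    using that unfolding labels_eq by (auto simp del: One_nat_def)
  have "0 \<le> p i" if "i \<in> {1..3}" for i
    using angle[OF that] nz[OF that] unfolding triangle_angle_def p_def
    by (metis vangle_le_pi_half_iff)
  \<comment> \<open>Both sides are the Gram determinant of the edge vectors at \<open>v 1\<close>
    (Lagrange's identity); this is where the area enters.\<close>
  moreover have "p 1 * p 2 + p 2 * p 3 + p 3 * p 1
      = (det (vector [v 2 - v 1, v 3 - v 1] :: real^2^2))\<^sup>2"
    unfolding p det_edges by (simp add: inner_vec_def sum_2) algebra
  ultimately have "p \<in> conway_symbols A"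
    unfolding det by (simp add: conway_symbols_def)
  moreover have "a = edges_of_conway p"
  proof (rule extensionalityI)
    show "a \<in> extensional {1..3}" "edges_of_conway p \<in> extensional {1..3}"
      by (auto simp: v(2) edge_lengths_def edges_of_conway_def)
    have "edge_lengths v 1 = sqrt (p 2 + p 3)" "edge_lengths v 2 = sqrt (p 1 + p 3)"
      "edge_lengths v 3 = sqrt (p 1 + p 2)"
      unfolding edge_lengths_simps dist_norm norm_eq_sqrt_inner p
      by (simp_all add: inner_vec_def sum_2 algebra_simps)
    then show "a i = edges_of_conway p i" if "i \<in> {1..3}" for i
      using that unfolding labels_eq by (auto simp: v(2) edges_of_conway_def add.commute simp del: One_nat_def)
  qed
  ultimately show "a \<in> edges_of_conway ` conway_symbols A" by blast
next
  fix a assume "a \<in> edges_of_conway ` conway_symbols A"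
  then obtain p where p: "p \<in> conway_symbols A" "a = edges_of_conway p" by blast
  have p0: "0 \<le> p 1" "0 \<le> p 2" "0 \<le> p 3"
    and pA: "p 1 * p 2 + p 2 * p 3 + p 3 * p 1 = 4 * A\<^sup>2"
    using p(1) by (auto simp: conway_symbols_def)
  have "p 1 + p 2 \<noteq> 0" using pA p0 assms by (auto simp: add_nonneg_eq_0_iff)
  then have pos: "p 1 + p 2 > 0" using p0 by linarith
  define c where "c = sqrt (p 1 + p 2)"
  have c: "c > 0" "c * c = p 1 + p 2" using pos by (auto simp: c_def)
  \<comment> \<open>The first vertex is the origin and the second lies on the axis at distance
    \<open>c\<close>. The third then has abscissa \<open>p 1 / c\<close>, forced by the dot product
    at \<open>v 1\<close>, and height \<open>2 * A / c\<close>, forced by the area.\<close>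
  define v :: "nat \<Rightarrow> real^2" where "v = (\<lambda>i\<in>{1..3}. if i = 1 then 0
    else if i = 2 then vector [c, 0] else vector [p 1 / c, 2 * A / c])"
  have v: "v (Suc 0) = 0" "v 2 = vector [c, 0]" "v 3 = vector [p 1 / c, 2 * A / c]"
    by (simp_all add: v_def)
  have det: "det (vector [v 2 - v 1, v 3 - v 1] :: real^2^2) = 2 * A"
    using c by (simp add: det_edges v)
  then have tri: "labeled_triangle v"
    using assms by (simp add: labeled_triangle_def v_def)
  have i1: "(v 2 - v 1) \<bullet> (v 3 - v 1) = p 1"
    using c by (simp add: v inner_vec_def sum_2)
  have i2: "(v 3 - v 2) \<bullet> (v 1 - v 2) = p 2"
    using c by (simp add: v inner_vec_def sum_2 field_simps)
  \<comment> \<open>The squared length of \<open>v 3\<close> is computed from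
    \<open>p 1 * p 1 + 4 * A\<^sup>2 = (p 1 + p 3) * (p 1 + p 2)\<close>, a rewriting of Heron's
    equation.\<close>
  have "(p 1 / c)\<^sup>2 + (2 * A / c)\<^sup>2 = (p 1 * p 1 + 4 * A\<^sup>2) / (c * c)"
    by (simp add: power2_eq_square add_divide_distrib)
  also have "\<dots> = (p 1 + p 3) * (p 1 + p 2) / (p 1 + p 2)"
    unfolding c(2) pA[symmetric] by (simp add: algebra_simps)
  also have "\<dots> = p 1 + p 3" using pos by simp
  finally have i3': "(p 1 / c)\<^sup>2 + (2 * A / c)\<^sup>2 = p 1 + p 3" .
  then have i3: "(v 1 - v 3) \<bullet> (v 2 - v 3) = p 3"
    using c by (simp add: v inner_vec_def sum_2 power2_eq_square algebra_simps)
  have ne: "v 2 \<noteq> v 3" "v 3 \<noteq> v 1" "v 1 \<noteq> v 2"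
    using tri by (auto simp: labeled_triangle_def det_edges)
  have "triangle_angle v i \<le> pi / 2" if "i \<in> {1..3}" for i
    using that ne p0 i1 i2 i3 unfolding labels_eq triangle_angle_def
    by (auto simp: vangle_le_pi_half_iff simp del: One_nat_def le_divide_eq_numeral1)
  moreover have "triangle_area v = A" using triangle_area_eq_det[OF tri] det by simp
  moreover have "a = edge_lengths v"
  proof (rule extensionalityI)
    show "a \<in> extensional {1..3}" "edge_lengths v \<in> extensional {1..3}"
      by (auto simp: p(2) edge_lengths_def edges_of_conway_def)
    have "(dist (v 2) (v 3))\<^sup>2 = p 2 + p 3" "(dist (v 3) (v 1))\<^sup>2 = p 1 + p 3"
      "(dist (v 1) (v 2))\<^sup>2 = p 1 + p 2"
      unfolding i1[symmetric] i2[symmetric] i3[symmetric]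
      by (simp_all add: dist_norm power2_norm_eq_inner inner_diff inner_commute algebra_simps)
    then have "dist (v 2) (v 3) = sqrt (p 2 + p 3)" "dist (v 3) (v 1) = sqrt (p 1 + p 3)"
      "dist (v 1) (v 2) = sqrt (p 1 + p 2)"
      by (metis real_sqrt_unique zero_le_dist)+
    then show "a i = edge_lengths v i" if "i \<in> {1..3}" for i
      using that unfolding labels_eq
      by (auto simp: p(2) edges_of_conway_def edge_lengths_simps add.commute simp del: One_nat_def)
  qed
  ultimately show "a \<in> AT_bar A" using tri by (auto simp: AT_bar_def)
qed

section \<open>Bounds on products of two edges\<close>

text \<open>Heron's equation is symmetric, so any two labels can be completed by the third one. This
  confines the split into six cases to one place.\<close>

lemma conway_triple:
  assumes "p \<in> conway_symbols A" "i \<in> {1..3}" "j \<in> {1..3}" "i \<noteq> j"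
  obtains k where "{i, j, k} = {1..3}" "p 1 + p 2 + p 3 = p i + p j + p k"
    "p i * p j + p j * p k + p k * p i = 4 * A\<^sup>2" "0 \<le> p i" "0 \<le> p j" "0 \<le> p k"
proof
  have ij: "(i, j) \<in> {(1,2),(1,3),(2,1),(2,3),(3,1),(3,2)}"
    using assms unfolding labels_eq by auto
  \<comment> \<open>The three labels sum to 6.\<close>
  let ?k = "6 - i - j"
  show "{i, j, ?k} = {1..3}" "p 1 + p 2 + p 3 = p i + p j + p ?k"
    "p i * p j + p j * p ?k + p ?k * p i = 4 * A\<^sup>2" "0 \<le> p i" "0 \<le> p j" "0 \<le> p ?k"
    using ij assms(1) unfolding conway_symbols_def labels_eq
    by (auto simp: algebra_simps)
qed

text \<open>Heron's equation gives
  \<open>(a i * a j)\<^sup>2 = 4 * A\<^sup>2 + (p k)\<^sup>2\<close> for the third label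
  \<open>k\<close>. Dropping \<open>p k\<close> yields the lower bound;
  \<open>p k \<le> (a i)\<^sup>2\<close> yields the upper one. The two bounds meet as
  \<open>a i\<close> tends to 0.\<close>

lemma AT_bar_edge_products:
  assumes "A > 0" "a \<in> AT_bar A" "i \<in> {1..3}" "j \<in> {1..3}" "i \<noteq> j"
  shows ln_edges_ge: "ln (2 * A) \<le> ln (a i) + ln (a j)"
    and ln_edges_le: "ln (a i) + ln (a j) \<le> ln (4 * A\<^sup>2 + exp (4 * ln (a i))) / 2"
proof -
  obtain p where p: "p \<in> conway_symbols A" "a = edges_of_conway p"
    using assms by (auto simp: AT_bar_eq_conway)
  obtain k where k: "p 1 + p 2 + p 3 = p i + p j + p k"
    "p i * p j + p j * p k + p k * p i = 4 * A\<^sup>2" "0 \<le> p i" "0 \<le> p j" "0 \<le> p k"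
    using conway_triple[OF p(1) assms(3-5)] .
  have pos: "a i > 0" "a j > 0" using AT_bar_pos[OF assms(2)] assms by auto
  have sq: "(a i)\<^sup>2 = p j + p k" "(a j)\<^sup>2 = p i + p k"
    using assms k by (simp_all add: p(2) edges_of_conway_def)
  have prod: "(a i * a j)\<^sup>2 = 4 * A\<^sup>2 + (p k)\<^sup>2"
    unfolding power_mult_distrib sq k(2)[symmetric] by (simp add: power2_eq_square algebra_simps)
  then have "(2 * A)\<^sup>2 \<le> (a i * a j)\<^sup>2" by (simp add: power_mult_distrib)
  then have "2 * A \<le> a i * a j"
    by (rule power2_le_imp_le) (use pos in simp)
  then have "ln (2 * A) \<le> ln (a i * a j)" using assms(1) pos by simp
  then show "ln (2 * A) \<le> ln (a i) + ln (a j)" using pos by (simp add: ln_mult)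
  have "exp (4 * ln (a i)) = ((a i)\<^sup>2)\<^sup>2"
    using pos exp_of_nat_mult[of 4 "ln (a i)"] by (simp flip: power_mult)
  moreover have "(p k)\<^sup>2 \<le> ((a i)\<^sup>2)\<^sup>2" unfolding sq using k by (intro power_mono) auto
  ultimately have "(a i * a j)\<^sup>2 \<le> 4 * A\<^sup>2 + exp (4 * ln (a i))" unfolding prod by simp
  then have "ln ((a i * a j)\<^sup>2) \<le> ln (4 * A\<^sup>2 + exp (4 * ln (a i)))"
    using pos by (subst ln_le_cancel_iff) (auto intro: add_nonneg_pos)
  then show "ln (a i) + ln (a j) \<le> ln (4 * A\<^sup>2 + exp (4 * ln (a i))) / 2"
    using pos by (simp add: ln_mult ln_realpow)
qed

text \<open>A long edge forces a short one: since \<open>(a i)\<^sup>2\<close> is the sum of the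
  other two symbols, one of them, \<open>p j\<close>, is at least half of it, while
  \<open>p j * (a j)\<^sup>2\<close> is at most \<open>4 * A\<^sup>2\<close> by Heron's
  equation.\<close>

lemma ex_short_edge:
  assumes "A > 0" "a \<in> AT_bar A" "i \<in> {1..3}"
  obtains j where "j \<in> {1..3}" "ln (a i) + ln (a j) \<le> ln (8 * A\<^sup>2) / 2"
proof -
  obtain p where p: "p \<in> conway_symbols A" "a = edges_of_conway p"
    using assms by (auto simp: AT_bar_eq_conway)
  obtain j where j: "j \<in> {1..3}" "i \<noteq> j" "2 * p j \<ge> (a i)\<^sup>2"
  proof -
    have "i \<noteq> next_label i" "next_label i \<in> {1..3}"
      using assms(3) unfolding labels_eq by auto
    then obtain k where "{i, next_label i, k} = {1..3}"
      "p 1 + p 2 + p 3 = p i + p (next_label i) + p k"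
      "0 \<le> p i" "0 \<le> p (next_label i)" "0 \<le> p k"
      using conway_triple[OF p(1) assms(3)] by metis
    moreover from this have "(a i)\<^sup>2 = p (next_label i) + p k"
      using assms by (simp add: p(2) edges_of_conway_def)
    moreover have "card {1..3::nat} = 3" by simp
    ultimately have "k \<noteq> i" using \<open>i \<noteq> next_label i\<close>
      by (metis card_2_iff insert_absorb2 insert_commute numeral_eq_iff num.distinct(5))
    show thesis
    proof (cases "2 * p k \<ge> (a i)\<^sup>2")
      case True
      then show ?thesis using that \<open>k \<noteq> i\<close> \<open>{i, next_label i, k} = {1..3}\<close> by blast
    next
      case False
      then show ?thesis
        using that[of "next_label i"] \<open>i \<noteq> next_label i\<close> \<open>next_label i \<in> {1..3}\<close>
          \<open>(a i)\<^sup>2 = p (next_label i) + p k\<close> by simp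
    qed
  qed
  obtain k where k: "p 1 + p 2 + p 3 = p i + p j + p k"
    "p i * p j + p j * p k + p k * p i = 4 * A\<^sup>2" "0 \<le> p i" "0 \<le> p j" "0 \<le> p k"
    using conway_triple[OF p(1) assms(3) j(1,2)] .
  have pos: "a i > 0" "a j > 0" using AT_bar_pos[OF assms(2)] assms j by auto
  have sq: "(a j)\<^sup>2 = p i + p k" using j k by (simp add: p(2) edges_of_conway_def)
  have "(a i * a j)\<^sup>2 = (a i)\<^sup>2 * (a j)\<^sup>2" by (simp add: power_mult_distrib)
  also have "\<dots> \<le> 2 * p j * (a j)\<^sup>2" using j(3) by (intro mult_right_mono) auto
  also have "\<dots> \<le> 8 * A\<^sup>2"
  proof -
    have "p j * (p i + p k) \<le> 4 * A\<^sup>2"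
      unfolding k(2)[symmetric] using mult_nonneg_nonneg[OF k(5,3)] by (simp add: algebra_simps)
    then show ?thesis unfolding sq by simp
  qed
  finally have "ln ((a i * a j)\<^sup>2) \<le> ln (8 * A\<^sup>2)"
    using pos assms(1) by (subst ln_le_cancel_iff) auto
  then have "ln (a i) + ln (a j) \<le> ln (8 * A\<^sup>2) / 2"
    using pos by (simp add: ln_mult ln_realpow)
  then show ?thesis using that j(1) by blast
qed

section \<open>Ends of the space and their Busemann functions\<close>

lemma mdist_AT_ge: "i \<in> {1..3} \<Longrightarrow> \<bar>ln (b i) - ln (a i)\<bar> \<le> mdist_AT a b"
  unfolding mdist_AT_def by (intro Max_ge) auto

lemma mdist_AT_le_iff: "mdist_AT a b \<le> d \<longleftrightarrow> (\<forall>i\<in>{1..3}. \<bar>ln (b i) - ln (a i)\<bar> \<le> d)"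
  unfolding mdist_AT_def by (subst Max_le_iff) auto

lemma mdist_AT_attained: "\<exists>i\<in>{1..3}. mdist_AT a b = \<bar>ln (b i) - ln (a i)\<bar>"
proof -
  have "mdist_AT a b \<in> (\<lambda>i. \<bar>ln (b i) - ln (a i)\<bar>) ` {1..3}"
    unfolding mdist_AT_def by (intro Max_in) auto
  then show ?thesis by auto
qed

text \<open>Far out, coordinate \<open>k\<close> contributes exactly
  \<open>ln (a k) - ln (q n k)\<close> to the distance. Every other coordinate of \<open>q n\<close>
  is close to \<open>ln (2 * A) - ln (q n k)\<close>, and \<open>ln (a i)\<close> is at least
  \<open>ln (2 * A) - ln (a k)\<close>, so no other coordinate contributes noticeably more.\<close>

lemma busemann_end:
  assumes "A > 0" "a \<in> AT_bar A" "k \<in> {1..3}" "\<And>n. q n \<in> AT_bar A"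
    and lim: "filterlim (\<lambda>n::nat. ln (q n k)) at_bot sequentially"
  shows "(\<lambda>n. mdist_AT a (q n) + ln (q n k)) \<longlonglongrightarrow> ln (a k)"
proof (rule tendsto_sandwich[where f = "\<lambda>_. ln (a k)"])
  \<comment> \<open>A bound for the excess of \<open>ln (q n k) + ln (q n i)\<close> over its
    minimum \<open>ln (2 * A)\<close>; it vanishes in the limit.\<close>
  define e where "e n = ln (4 * A\<^sup>2 + exp (4 * ln (q n k))) / 2 - ln (2 * A)" for n
  have "((\<lambda>t. ln (4 * A\<^sup>2 + exp (4 * t)) / 2 - ln (2 * A)) \<longlongrightarrow> ln (4 * A\<^sup>2 + 0) / 2 - ln (2 * A)) at_bot"
    using assms(1)
    by (intro tendsto_intros filterlim_compose[OF exp_at_bot]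
        filterlim_tendsto_pos_mult_at_bot[OF tendsto_const] filterlim_ident) auto
  moreover have "ln (4 * A\<^sup>2 + 0) / 2 = ln (2 * A)"
    using assms(1) ln_realpow[of "2 * A" 2] by (simp add: power_mult_distrib)
  ultimately have "e \<longlonglongrightarrow> 0"
    unfolding e_def using filterlim_compose[OF _ lim] by fastforce
  then show "(\<lambda>n. ln (a k) + e n) \<longlonglongrightarrow> ln (a k)"
    using tendsto_add[OF tendsto_const[of "ln (a k)"]] by fastforce
  show "\<forall>\<^sub>F n in sequentially. ln (a k) \<le> mdist_AT a (q n) + ln (q n k)"
  proof (intro always_eventually allI)
    fix n
    show "ln (a k) \<le> mdist_AT a (q n) + ln (q n k)"
      using mdist_AT_ge[OF assms(3), of "q n" a] by linarith
  qed
  \<comment> \<open>Below this threshold \<open>ln (a i) - ln (q n i)\<close>, the difference with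
    the other sign, is also at most \<open>ln (a k) - ln (q n k)\<close>.\<close>
  define M where "M = Min ((\<lambda>i. (ln (a k) - ln (a i) + ln (2 * A)) / 2) ` {1..3})"
  have M: "M \<le> (ln (a k) - ln (a i) + ln (2 * A)) / 2" if "i \<in> {1..3}" for i
    unfolding M_def using that by (intro Min_le) auto
  have "\<forall>\<^sub>F n in sequentially. ln (q n k) \<le> min M (ln (a k))"
    using lim unfolding filterlim_at_bot by blast
  then show "\<forall>\<^sub>F n in sequentially. mdist_AT a (q n) + ln (q n k) \<le> ln (a k) + e n"
  proof eventually_elim
    case (elim n)
    have e: "0 \<le> e n"
    proof -
      have "ln ((2 * A)\<^sup>2) \<le> ln (4 * A\<^sup>2 + exp (4 * ln (q n k)))"
        using assms(1) by (subst ln_le_cancel_iff) (auto simp: power_mult_distrib intro: add_nonneg_pos)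
      then show ?thesis unfolding e_def using ln_realpow[of "2 * A" 2] assms(1) by simp
    qed
    have "\<bar>ln (q n i) - ln (a i)\<bar> \<le> ln (a k) + e n - ln (q n k)" if i: "i \<in> {1..3}" for i
    proof (cases "i = k")
      case True
      then show ?thesis using elim e by simp
    next
      case False
      then show ?thesis
        using ln_edges_ge[OF assms(1,2,3) i] ln_edges_ge[OF assms(1) assms(4)[of n] assms(3) i]
          ln_edges_le[OF assms(1) assms(4)[of n] assms(3) i] M[OF i] elim e
        unfolding e_def by (simp add: abs_le_iff)
    qed
    then have "mdist_AT a (q n) \<le> ln (a k) + e n - ln (q n k)"
      by (simp add: mdist_AT_le_iff)
    then show ?case by simp
  qed
qed simp

text \<open>Some coordinate realizes the distance from \<open>b\<close>. Either this edge is itself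
  short, or it is long and \<open>ex_short_edge\<close> supplies a short companion. Hence points far
  from \<open>b\<close> have a very short edge.\<close>

lemma ex_edge_le_mdist:
  assumes "A > 0"
  obtains C where
    "\<And>a. a \<in> AT_bar A \<Longrightarrow> \<exists>k\<in>{1..3}. ln (a k) \<le> C - mdist_AT b a"
proof -
  define C where "C = Max ((\<lambda>i. max (ln (b i)) (ln (8 * A\<^sup>2) / 2 - ln (b i))) ` {1..3})"
  have C: "ln (b i) \<le> C" "ln (8 * A\<^sup>2) / 2 - ln (b i) \<le> C" if "i \<in> {1..3}" for i
  proof -
    have "max (ln (b i)) (ln (8 * A\<^sup>2) / 2 - ln (b i)) \<le> C"
      unfolding C_def using that by (intro Max_ge) auto
    then show "ln (b i) \<le> C" "ln (8 * A\<^sup>2) / 2 - ln (b i) \<le> C" by auto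
  qed
  have "\<exists>k\<in>{1..3}. ln (a k) \<le> C - mdist_AT b a" if a: "a \<in> AT_bar A" for a
  proof -
    obtain i where i: "i \<in> {1..3}" "mdist_AT b a = \<bar>ln (a i) - ln (b i)\<bar>"
      using mdist_AT_attained[of b a] by blast
    obtain j where j: "j \<in> {1..3}" "ln (a i) + ln (a j) \<le> ln (8 * A\<^sup>2) / 2"
      using ex_short_edge[OF assms a i(1)] .
    show ?thesis
    proof (cases "ln (a i) \<le> ln (b i)")
      case True
      then show ?thesis using i C(1)[OF i(1)] by (intro bexI[of _ i]) auto
    next
      case False
      then show ?thesis using i j C(2)[OF i(1)] by (intro bexI[of _ j]) auto
    qed
  qed
  then show ?thesis using that by blast
qed

text \<open>
  At most one edge is shorter than \<open>sqrt (2 A)\<close>, so far out a sequence with bounded steps cannot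
  change the label of its short edge.
\<close>

lemma sequence_tends_to_end:
  assumes "A > 0" "\<And>n. q n \<in> AT_bar A"
    and step: "\<And>n. mdist_AT (q n) (q (Suc n)) \<le> M"
    and inf: "filterlim (\<lambda>n. mdist_AT (q 0) (q n)) at_top sequentially"
  obtains k where "k \<in> {1..3}" "filterlim (\<lambda>n. ln (q n k)) at_bot sequentially"
proof -
  obtain C where "\<And>a. a \<in> AT_bar A \<Longrightarrow> \<exists>k\<in>{1..3}. ln (a k) \<le> C - mdist_AT (q 0) a"
    using ex_edge_le_mdist[OF assms(1)] by blast
  then have "\<exists>k\<in>{1..3}. ln (q n k) \<le> C - mdist_AT (q 0) (q n)" for n using assms(2) by blast
  then obtain k where k: "\<And>n. k n \<in> {1..3}"
    "\<And>n. ln (q n (k n)) \<le> C - mdist_AT (q 0) (q n)" by metis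
  \<comment> \<open>The margin \<open>\<bar>M\<bar> + 1\<close> keeps the short edge below
    \<open>sqrt (2 * A)\<close> after one more step, so two different labels would contradict
    \<open>ln_edges_ge\<close>.\<close>
  have "\<forall>\<^sub>F n in sequentially. C - ln (2 * A) / 2 + \<bar>M\<bar> + 1 \<le> mdist_AT (q 0) (q n)"
    using inf by (simp add: filterlim_at_top)
  then obtain N where N: "\<And>n. n \<ge> N \<Longrightarrow> C - ln (2 * A) / 2 + \<bar>M\<bar> + 1 \<le> mdist_AT (q 0) (q n)"
    by (auto simp: eventually_sequentially)
  have stay: "k (Suc n) = k n" if "n \<ge> N" for n
  proof (rule ccontr)
    assume "k (Suc n) \<noteq> k n"
    then have "ln (2 * A) \<le> ln (q (Suc n) (k (Suc n))) + ln (q (Suc n) (k n))"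
      by (rule ln_edges_ge[OF assms(1) assms(2) k(1) k(1)])
    moreover have "\<bar>ln (q (Suc n) (k n)) - ln (q n (k n))\<bar> \<le> M"
      using mdist_AT_ge[OF k(1)[of n], of "q (Suc n)" "q n"] step[of n] by linarith
    ultimately show False using k(2)[of n] k(2)[of "Suc n"] N[of n] N[of "Suc n"] that by linarith
  qed
  have const: "k n = k N" if "n \<ge> N" for n
    using that by (induction n rule: dec_induct) (auto simp: stay)
  have "filterlim (\<lambda>n. ln (q n (k N))) at_bot sequentially"
    unfolding filterlim_at_bot
  proof
    fix Z
    have "\<forall>\<^sub>F n in sequentially. C - Z \<le> mdist_AT (q 0) (q n)"
      using inf unfolding filterlim_at_top by blast
    then show "\<forall>\<^sub>F n in sequentially. ln (q n (k N)) \<le> Z"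
      using eventually_ge_at_top[of N]
    proof eventually_elim
      case (elim n)
      then show ?case using k(2)[of n] const[OF elim(2)] by simp
    qed
  qed
  then show ?thesis using that k(1) by blast
qed

section \<open>Explicit sequences and triangles\<close>

lemma mdist_edges_of_conway_le:
  assumes "A > 0" "p \<in> conway_symbols A" "p' \<in> conway_symbols A"
    and le: "\<And>i. p' i \<le> 2 * p i" "\<And>i. p i \<le> 2 * p' i"
  shows "mdist_AT (edges_of_conway p) (edges_of_conway p') \<le> ln 2"
proof -
  have *: "ln (edges_of_conway p' i) \<le> ln (edges_of_conway p i) + ln 2"
    if i: "i \<in> {1..3}" and p: "p \<in> conway_symbols A" "p' \<in> conway_symbols A"
      and le: "\<And>i. p' i \<le> 2 * p i" for i p p'
  proof -
    have pos: "edges_of_conway p i > 0" "edges_of_conway p' i > 0"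
      using AT_bar_pos[of _ A i] i p assms(1) by (auto simp: AT_bar_eq_conway)
    \<comment> \<open>The coarse factor 4 in place of 2 has an integral square root, which gives the
      bound \<open>ln 2\<close>.\<close>
    have "p' 1 + p' 2 + p' 3 - p' i \<le> 4 * (p 1 + p 2 + p 3 - p i)"
      using i le[of 1] le[of 2] le[of 3] p unfolding labels_eq conway_symbols_def by auto
    then have "edges_of_conway p' i \<le> sqrt (2\<^sup>2 * (p 1 + p 2 + p 3 - p i))"
      using i by (auto simp: edges_of_conway_def)
    also have "\<dots> = 2 * edges_of_conway p i"
      unfolding real_sqrt_mult using i by (simp add: edges_of_conway_def)
    finally have "ln (edges_of_conway p' i) \<le> ln (2 * edges_of_conway p i)"
      using pos by simp
    then show ?thesis using pos by (simp add: ln_mult)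
  qed
  show ?thesis
    using *[OF _ assms(2,3) le(1)] *[OF _ assms(3,2) le(2)]
    by (auto simp: mdist_AT_le_iff abs_le_iff algebra_simps)
qed

lemma ex_end_sequence:
  assumes "A > 0" "k \<in> {1..3}"
  obtains q where "\<And>n. q n \<in> AT_bar A" "\<And>n. mdist_AT (q n) (q (Suc n)) \<le> ln 2"
    "filterlim (\<lambda>n::nat. ln (q n k)) at_bot sequentially"
proof
  \<comment> \<open>Right triangles with the right angle at the third label. Doubling one symbol and
    halving the other preserves the area, moves by a bounded step and sends \<open>a k\<close> to
    0.\<close>
  define p where "p n j = (if j = k then 2 * A * 2 ^ n
    else if j = next_label k then 2 * A / 2 ^ n else 0)" for n :: nat and j
  have p: "p n \<in> conway_symbols A" for n
    using assms unfolding labels_eq conway_symbols_def p_def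
    by (auto simp: power2_eq_square)
  show "edges_of_conway (p n) \<in> AT_bar A" for n
    using p assms by (simp add: AT_bar_eq_conway)
  show "mdist_AT (edges_of_conway (p n)) (edges_of_conway (p (Suc n))) \<le> ln 2" for n
    by (rule mdist_edges_of_conway_le[OF assms(1) p p])
       (use assms(1) in \<open>auto simp: p_def field_simps\<close>)
  have "g 1 + g 2 + g 3 - g k = u" if "g = (\<lambda>j. if j = k then t else if j = next_label k then u else 0)"
    for g :: "nat \<Rightarrow> real" and t u
    using assms(2) unfolding labels_eq that by auto
  from this[of "p n" for n] have "edges_of_conway (p n) k = sqrt (2 * A / 2 ^ n)" for n
    using assms(2) by (simp add: edges_of_conway_def p_def fun_eq_iff)
  then have "ln (edges_of_conway (p n) k) = ln (2 * A) / 2 - real n * (ln 2 / 2)" for n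
    using assms(1) by (simp add: ln_sqrt ln_div ln_mult ln_realpow diff_divide_distrib)
  moreover have "filterlim (\<lambda>n. ln (2 * A) / 2 - real n * (ln 2 / 2)) at_bot sequentially"
    by real_asymp
  ultimately show "filterlim (\<lambda>n. ln (edges_of_conway (p n) k)) at_bot sequentially"
    by simp
qed

lemma ex_right_triangle:
  assumes "A > 0" "i \<in> {1..3}" "j \<in> {1..3}" "i \<noteq> j"
  obtains a where "a \<in> AT_bar A" "ln (a i) + ln (a j) = ln (2 * A)"
proof
  \<comment> \<open>The isosceles right triangle whose legs are the edges \<open>i\<close> and
    \<open>j\<close>.\<close>
  define p where "p l = (if l = i \<or> l = j then 2 * A else 0)" for l
  have "p \<in> conway_symbols A"
    using assms unfolding labels_eq conway_symbols_def p_def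
    by (auto simp: power2_eq_square)
  then show "edges_of_conway p \<in> AT_bar A" using assms(1) by (simp add: AT_bar_eq_conway)
  have "edges_of_conway p i = sqrt (2 * A)" "edges_of_conway p j = sqrt (2 * A)"
    using assms unfolding labels_eq by (auto simp: edges_of_conway_def p_def)
  then show "ln (edges_of_conway p i) + ln (edges_of_conway p j) = ln (2 * A)"
    using assms(1) by (simp add: ln_sqrt)
qed

lemma ex_scalene_triangle:
  assumes "A > 0"
  obtains a where "a \<in> AT_bar A" "inj_on a {1..3}"
proof
  \<comment> \<open>The triangle with angle cotangents \<open>1/2\<close>, \<open>1\<close>, \<open>1/3\<close>.\<close>
  define p where "p l = (if l = 1 then A else if l = 2 then 2 * A else 2 * A / 3)" for l :: nat
  have "p \<in> conway_symbols A"
    using assms unfolding conway_symbols_def p_def by (auto simp: power2_eq_square)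
  then show "edges_of_conway p \<in> AT_bar A" using assms(1) by (simp add: AT_bar_eq_conway)
  show "inj_on (edges_of_conway p) {1..3}"
    using assms unfolding labels_eq by (auto simp: edges_of_conway_def p_def inj_on_def)
qed

section \<open>Permutations of edges as isometries\<close>

lemma permute_edges_apply:
  "a \<in> AT_bar A \<Longrightarrow> i \<in> {1..3} \<Longrightarrow> permute_edges A \<sigma> a i = a (\<sigma> i)"
  by (simp add: permute_edges_def)

lemma permute_edges_closed:
  assumes "A > 0" "\<sigma> permutes {1..3}" "a \<in> AT_bar A"
  shows "permute_edges A \<sigma> a \<in> AT_bar A"
proof -
  obtain p where p: "p \<in> conway_symbols A" "a = edges_of_conway p"
    using assms by (auto simp: AT_bar_eq_conway)
  have sum3: "(\<Sum>i\<in>{1..3}. g i) = g 1 + g 2 + g 3" for g :: "nat \<Rightarrow> real"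
    unfolding labels_eq by simp
  have perm: "g (\<sigma> 1) + g (\<sigma> 2) + g (\<sigma> 3) = g 1 + g 2 + g 3" for g :: "nat \<Rightarrow> real"
    using sum.permute[OF assms(2), of g] unfolding sum3 by simp
  \<comment> \<open>Written through power sums, the Heron form is visibly symmetric: each power sum
    is a sum over all labels.\<close>
  have *: "g 1 * g 2 + g 2 * g 3 + g 3 * g 1
      = ((g 1 + g 2 + g 3)\<^sup>2 - ((g 1)\<^sup>2 + (g 2)\<^sup>2 + (g 3)\<^sup>2)) / 2" for g :: "nat \<Rightarrow> real"
    by (simp add: power2_eq_square algebra_simps)
  have "(p \<circ> \<sigma>) 1 * (p \<circ> \<sigma>) 2 + (p \<circ> \<sigma>) 2 * (p \<circ> \<sigma>) 3 + (p \<circ> \<sigma>) 3 * (p \<circ> \<sigma>) 1 = 4 * A\<^sup>2"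
    using p(1) perm[of p] perm[of "\<lambda>i. (p i)\<^sup>2"]
    unfolding * conway_symbols_def by simp
  moreover have "0 \<le> (p \<circ> \<sigma>) i" if "i \<in> {1..3}" for i
    using p(1) permutes_in_image[OF assms(2)] that by (auto simp: conway_symbols_def)
  ultimately have "p \<circ> \<sigma> \<in> conway_symbols A" by (simp add: conway_symbols_def)
  moreover have "permute_edges A \<sigma> a = edges_of_conway (p \<circ> \<sigma>)"
  proof (rule extensionalityI)
    show "permute_edges A \<sigma> a \<in> extensional {1..3}" "edges_of_conway (p \<circ> \<sigma>) \<in> extensional {1..3}"
      using assms(3) by (auto simp: permute_edges_def edges_of_conway_def)
    show "permute_edges A \<sigma> a i = edges_of_conway (p \<circ> \<sigma>) i" if "i \<in> {1..3}" for i
      using that permutes_in_image[OF assms(2), of i] perm[of p]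
      by (simp only: permute_edges_apply[OF assms(3)])
         (simp add: p(2) edges_of_conway_def)
  qed
  ultimately show ?thesis using assms(1) by (simp add: AT_bar_eq_conway)
qed

text \<open>Permutations act by precomposition on the labels, which reverses the order of
  composition.\<close>

lemma compose_permute_edges:
  assumes "A > 0" "\<sigma> permutes {1..3}" "\<tau> permutes {1..3}"
  shows "compose (AT_bar A) (permute_edges A \<sigma>) (permute_edges A \<tau>) = permute_edges A (\<tau> \<circ> \<sigma>)"
proof (rule extensionalityI)
  show "compose (AT_bar A) (permute_edges A \<sigma>) (permute_edges A \<tau>) \<in> extensional (AT_bar A)"
    "permute_edges A (\<tau> \<circ> \<sigma>) \<in> extensional (AT_bar A)"
    by (auto simp: compose_def permute_edges_def)
  fix a assume a: "a \<in> AT_bar A"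
  have "permute_edges A \<sigma> (permute_edges A \<tau> a) i = permute_edges A (\<tau> \<circ> \<sigma>) a i" for i
    using permute_edges_closed[OF assms(1,3) a] a permutes_in_image[OF assms(2), of i]
    by (simp add: permute_edges_def)
  then show "compose (AT_bar A) (permute_edges A \<sigma>) (permute_edges A \<tau>) a = permute_edges A (\<tau> \<circ> \<sigma>) a"
    using a by (auto simp: compose_eq)
qed

lemma permute_edges_id: "permute_edges A id = (\<lambda>a\<in>AT_bar A. a)"
  using AT_bar_extensional by (fastforce simp: permute_edges_def extensional_restrict)

lemma carrier_Isom_AT:
  "carrier (Isom_AT A) =
    {f \<in> Bij (AT_bar A). \<forall>a\<in>AT_bar A. \<forall>b\<in>AT_bar A. mdist_AT (f a) (f b) = mdist_AT a b}"
  by (simp add: Isom_AT_def isometry_group_def)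

lemma permute_edges_in_Isom_AT:
  assumes "A > 0" "\<sigma> permutes {1..3}"
  shows "permute_edges A \<sigma> \<in> carrier (Isom_AT A)"
proof -
  have inverse: "permute_edges A \<tau> (permute_edges A \<rho> a) = a"
    if "\<tau> permutes {1..3}" "\<rho> permutes {1..3}" "\<rho> \<circ> \<tau> = id" "a \<in> AT_bar A" for \<tau> \<rho> a
    using fun_cong[OF compose_permute_edges[OF assms(1) that(1,2)], of a] that(3,4)
    by (simp add: compose_eq permute_edges_id)
  have inv: "inv' \<sigma> permutes {1..3}" using assms(2) by (rule permutes_inv)
  have "bij_betw (permute_edges A \<sigma>) (AT_bar A) (AT_bar A)"
    by (rule bij_betw_byWitness[where f' = "permute_edges A (inv' \<sigma>)"])
       (use permute_edges_closed[OF assms(1)] assms(2) inv inverse permutes_inv_o[OF assms(2)] in auto)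
  then have "permute_edges A \<sigma> \<in> Bij (AT_bar A)"
    by (simp add: Bij_def permute_edges_def)
  moreover have "mdist_AT (permute_edges A \<sigma> a) (permute_edges A \<sigma> b) = mdist_AT a b"
    if a: "a \<in> AT_bar A" and b: "b \<in> AT_bar A" for a b
  proof -
    have "(\<lambda>i. \<bar>ln (permute_edges A \<sigma> b i) - ln (permute_edges A \<sigma> a i)\<bar>) ` {1..3}
        = (\<lambda>i. \<bar>ln (b i) - ln (a i)\<bar>) ` \<sigma> ` {1..3}"
      unfolding image_image by (rule image_cong) (simp_all add: permute_edges_apply a b)
    then show ?thesis
      unfolding mdist_AT_def permutes_image[OF assms(2)] by simp
  qed
  ultimately show ?thesis by (simp add: carrier_Isom_AT)
qed

text \<open>The three edge lengths of a scalene triangle are distinct, so their rearrangement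
  reveals the permutation.\<close>

lemma inj_on_permute_edges:
  assumes "A > 0"
  shows "inj_on (permute_edges A) {\<sigma>. \<sigma> permutes {1..3}}"
proof (rule inj_onI)
  fix \<sigma> \<tau> :: "nat \<Rightarrow> nat"
  assume st: "\<sigma> \<in> {\<sigma>. \<sigma> permutes {1..3}}" "\<tau> \<in> {\<sigma>. \<sigma> permutes {1..3}}"
    and eq: "permute_edges A \<sigma> = permute_edges A \<tau>"
  obtain a where a: "a \<in> AT_bar A" "inj_on a {1..3}" using ex_scalene_triangle[OF assms] .
  show "\<sigma> = \<tau>"
  proof
    fix i
    show "\<sigma> i = \<tau> i"
    proof (cases "i \<in> {1..3}")
      case True
      then have "a (\<sigma> i) = a (\<tau> i)" using eq permute_edges_apply[OF a(1) True] by metis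
      moreover have "\<sigma> i \<in> {1..3}" "\<tau> i \<in> {1..3}"
        using st True by (metis mem_Collect_eq permutes_in_image)+
      ultimately show ?thesis using a(2) by (metis inj_onD)
    next
      case False
      then show ?thesis using st by (metis mem_Collect_eq permutes_not_in)
    qed
  qed
qed

section \<open>Rigidity of isometries\<close>

text \<open>A sequence running into end \<open>i\<close> with bounded steps is mapped to one that
  again has bounded steps and leaves every bounded set, hence runs into some end \<open>k\<close>.
  An isometry therefore matches the two Busemann functions up to a constant.\<close>

lemma isometry_translates_log_edge:
  assumes "A > 0" "f \<in> carrier (Isom_AT A)" "i \<in> {1..3}"
  shows "\<exists>k\<in>{1..3}. \<exists>b. \<forall>a\<in>AT_bar A. ln (f a k) = ln (a i) + b"
proof -
  have f: "f a \<in> AT_bar A" "c \<in> AT_bar A \<Longrightarrow> mdist_AT (f a) (f c) = mdist_AT a c"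
    if "a \<in> AT_bar A" for a c
    using that assms(2) Bij_imp_funcset by (auto simp: carrier_Isom_AT)
  obtain q where q: "\<And>n. q n \<in> AT_bar A" "\<And>n. mdist_AT (q n) (q (Suc n)) \<le> ln 2"
    and q_lim: "filterlim (\<lambda>n::nat. ln (q n i)) at_bot sequentially"
    using ex_end_sequence[OF assms(1,3)] by blast
  have "filterlim (\<lambda>n. mdist_AT (q 0) (q n)) at_top sequentially"
    unfolding filterlim_at_top
  proof
    fix Z
    have "\<forall>\<^sub>F n in sequentially. ln (q n i) \<le> ln (q 0 i) - Z"
      using q_lim unfolding filterlim_at_bot by blast
    then show "\<forall>\<^sub>F n in sequentially. Z \<le> mdist_AT (q 0) (q n)"
    proof eventually_elim
      case (elim n)
      then show ?case using mdist_AT_ge[OF assms(3), of "q n" "q 0"] by linarith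
    qed
  qed
  then obtain k where k: "k \<in> {1..3}"
    and fq_lim: "filterlim (\<lambda>n. ln (f (q n) k)) at_bot sequentially"
    using sequence_tends_to_end[of A "\<lambda>n. f (q n)" "ln 2"] assms(1) f q by auto
  \<comment> \<open>In the difference of the two Busemann limits the equal distances cancel. What
    remains is a sequence independent of \<open>a\<close>, so its limit is the wanted
    constant.\<close>
  have lim: "(\<lambda>n. ln (f (q n) k) - ln (q n i)) \<longlonglongrightarrow> ln (f a k) - ln (a i)"
    if a: "a \<in> AT_bar A" for a
    using tendsto_diff[OF busemann_end[OF assms(1) f(1)[OF a] k f(1)[OF q(1)] fq_lim]
      busemann_end[OF assms(1) a assms(3) q(1) q_lim]] f(2)[OF a q(1)]
    by simp
  have "ln (f a k) = ln (a i) + (ln (f (q 0) k) - ln (q 0 i))" if "a \<in> AT_bar A" for a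
    using LIMSEQ_unique[OF lim[OF that] lim[OF q(1)[of 0]]] by simp
  then show ?thesis using k by blast
qed

lemma isometry_is_permute_edges:
  assumes "A > 0" "f \<in> carrier (Isom_AT A)"
  obtains \<sigma> where "\<sigma> permutes {1..3}" "f = permute_edges A \<sigma>"
proof -
  have f: "f \<in> extensional (AT_bar A)" "bij_betw f (AT_bar A) (AT_bar A)"
    using assms(2) by (auto simp: carrier_Isom_AT Bij_def)
  have fAT: "f a \<in> AT_bar A" if "a \<in> AT_bar A" for a
    using f(2) that by (rule bij_betwE[rule_format])
  obtain s b where s: "\<And>i. i \<in> {1..3} \<Longrightarrow> s i \<in> {1..3}"
    and b: "\<And>i a. i \<in> {1..3} \<Longrightarrow> a \<in> AT_bar A \<Longrightarrow> ln (f a (s i)) = ln (a i) + b i"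
    using isometry_translates_log_edge[OF assms] by metis
  have ne: "s i \<noteq> s j" if ij: "i \<in> {1..3}" "j \<in> {1..3}" "i \<noteq> j" for i j
  proof
    assume eq: "s i = s j"
    \<comment> \<open>If the labels coincided, \<open>ln (a i) - ln (a j)\<close> would be constant
      on the space; swapping two unequal edges changes its sign.\<close>
    obtain a where a: "a \<in> AT_bar A" "inj_on a {1..3}" using ex_scalene_triangle[OF assms(1)] .
    define a' where "a' = permute_edges A (Transposition.transpose i j) a"
    have a': "a' \<in> AT_bar A" "a' i = a j" "a' j = a i"
      using ij permute_edges_closed[OF assms(1) permutes_swap_id[OF ij(1,2)] a(1)]
      by (auto simp: a'_def permute_edges_apply[OF a(1)])
    have "ln (a i) = ln (a j)"
      using b[OF ij(1) a(1)] b[OF ij(2) a(1)] b[OF ij(1) a'(1)] b[OF ij(2) a'(1)] eq a'(2,3) by simp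
    then have "a i = a j" using AT_bar_pos[OF a(1)] ij by (metis ln_inj_iff)
    then show False using a(2) ij by (metis inj_onD)
  qed
  \<comment> \<open>The minimum \<open>ln (2 * A)\<close> is tested on both sides: at a right
    triangle and its image for one inequality, at a right triangle and its preimage for the
    other.\<close>
  have b_sum: "b i + b j = 0" if ij: "i \<in> {1..3}" "j \<in> {1..3}" "i \<noteq> j" for i j
  proof (rule antisym)
    obtain a where a: "a \<in> AT_bar A" "ln (a i) + ln (a j) = ln (2 * A)"
      using ex_right_triangle[OF assms(1) ij] .
    show "0 \<le> b i + b j"
      using ln_edges_ge[OF assms(1) fAT[OF a(1)] s[OF ij(1)] s[OF ij(2)] ne[OF ij]]
        b[OF ij(1) a(1)] b[OF ij(2) a(1)] a(2) by linarith
    obtain c where c: "c \<in> AT_bar A" "ln (c (s i)) + ln (c (s j)) = ln (2 * A)"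
      using ex_right_triangle[OF assms(1) s[OF ij(1)] s[OF ij(2)] ne[OF ij]] .
    obtain d where d: "d \<in> AT_bar A" "c = f d"
      using c(1) f(2) by (metis bij_betw_imp_surj_on imageE)
    show "b i + b j \<le> 0"
      using ln_edges_ge[OF assms(1) d(1) ij] b[OF ij(1) d(1)] b[OF ij(2) d(1)] c(2)
      unfolding d(2) by linarith
  qed
  have b0: "b i = 0" if "i \<in> {1..3}" for i
    using that b_sum[of 1 2] b_sum[of 2 3] b_sum[of 3 1] unfolding labels_eq by auto
  have edge: "f a (s i) = a i" if "a \<in> AT_bar A" "i \<in> {1..3}" for a i
    using b[OF that(2,1)] b0[OF that(2)] AT_bar_pos[OF that] AT_bar_pos[OF fAT[OF that(1)] s[OF that(2)]]
    by (simp add: ln_inj_iff)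
  \<comment> \<open>Off the labels the map is the identity, as \<open>permutes\<close>
    demands.\<close>
  define \<sigma> where "\<sigma> i = (if i \<in> {1..3} then s i else i)" for i
  have "inj_on \<sigma> {1..3}" using ne unfolding \<sigma>_def inj_on_def by metis
  moreover have "\<sigma> ` {1..3} \<subseteq> {1..3}" using s by (auto simp: \<sigma>_def)
  ultimately have "bij_betw \<sigma> {1..3} {1..3}"
    by (simp add: bij_betw_def endo_inj_surj)
  then have \<sigma>: "\<sigma> permutes {1..3}"
    by (rule bij_imp_permutes) (auto simp: \<sigma>_def)
  \<comment> \<open>The relation \<open>f a (s i) = a i\<close> moves edge \<open>i\<close> to place
    \<open>s i\<close>, whereas \<open>permute_edges\<close> reads off the source of each place;
    hence the inverse.\<close>
  have "f = permute_edges A (inv' \<sigma>)"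
  proof (rule extensionalityI[OF f(1)])
    show "permute_edges A (inv' \<sigma>) \<in> extensional (AT_bar A)" by (simp add: permute_edges_def)
    fix a assume a: "a \<in> AT_bar A"
    show "f a = permute_edges A (inv' \<sigma>) a"
    proof (rule extensionalityI[OF AT_bar_extensional[OF fAT[OF a]]])
      show "permute_edges A (inv' \<sigma>) a \<in> extensional {1..3}"
        using a by (simp add: permute_edges_def)
      fix l :: nat assume l: "l \<in> {1..3}"
      have i: "inv' \<sigma> l \<in> {1..3}" using permutes_in_image[OF permutes_inv[OF \<sigma>]] l by blast
      have "s (inv' \<sigma> l) = l" using i permutes_inverses(1)[OF \<sigma>, of l] by (simp add: \<sigma>_def)
      then show "f a l = permute_edges A (inv' \<sigma>) a l"
        using edge[OF a i] permute_edges_apply[OF a l] by simp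
    qed
  qed
  then show ?thesis using that permutes_inv[OF \<sigma>] by blast
qed

section \<open>Identification with the symmetric group\<close>

theorem theorem7:
  fixes A :: real
  assumes "A > 0"
  shows "carrier (Isom_AT A) = permute_edges A ` {\<sigma>. \<sigma> permutes {1..3}}
    \<and> Isom_AT A \<cong> sym_group 3"
proof
  let ?P = "{\<sigma>. \<sigma> permutes {1..3::nat}}"
  show carrier: "carrier (Isom_AT A) = permute_edges A ` ?P"
    using isometry_is_permute_edges[OF assms] permute_edges_in_Isom_AT[OF assms] by blast
  have mult: "f \<otimes>\<^bsub>Isom_AT A\<^esub> g = compose (AT_bar A) f g"
    if "f \<in> carrier (Isom_AT A)" "g \<in> carrier (Isom_AT A)" for f g
    using that unfolding carrier_Isom_AT
    by (simp add: Isom_AT_def isometry_group_def BijGroup_def)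
  \<comment> \<open>\<open>permute_edges\<close> is an anti-homomorphism, hence the inverse.\<close>
  define h where "h \<sigma> = permute_edges A (inv' \<sigma>)" for \<sigma>
  have "inj_on h ?P"
  proof (rule inj_onI)
    fix \<sigma> \<tau> :: "nat \<Rightarrow> nat" assume "\<sigma> \<in> ?P" "\<tau> \<in> ?P" "h \<sigma> = h \<tau>"
    then have "inv' \<sigma> = inv' \<tau>"
      using inj_onD[OF inj_on_permute_edges[OF assms]] permutes_inv unfolding h_def by blast
    then show "\<sigma> = \<tau>" using \<open>\<sigma> \<in> ?P\<close> \<open>\<tau> \<in> ?P\<close> by (metis mem_Collect_eq permutes_inv_inv)
  qed
  moreover have "h ` ?P = carrier (Isom_AT A)"
  proof -
    have "h ` ?P = permute_edges A ` inv' ` ?P" by (simp add: h_def image_image)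
    also have "inv' ` ?P = ?P"
    proof (intro equalityI subsetI)
      show "\<sigma> \<in> ?P" if "\<sigma> \<in> inv' ` ?P" for \<sigma>
        using that permutes_inv by blast
      show "\<sigma> \<in> inv' ` ?P" if "\<sigma> \<in> ?P" for \<sigma>
        using that permutes_inv[of \<sigma>] permutes_inv_inv[of \<sigma>]
        by (intro image_eqI[of _ _ "inv' \<sigma>"]) auto
    qed
    finally show ?thesis by (simp only: carrier)
  qed
  moreover have "h (\<sigma> \<circ> \<tau>) = h \<sigma> \<otimes>\<^bsub>Isom_AT A\<^esub> h \<tau>" if "\<sigma> \<in> ?P" "\<tau> \<in> ?P" for \<sigma> \<tau>
  proof -
    have perm: "\<sigma> permutes {1..3}" "\<tau> permutes {1..3}" using that by auto
    then have "inv' (\<sigma> \<circ> \<tau>) = inv' \<tau> \<circ> inv' \<sigma>" by (simp add: o_inv_distrib permutes_bij)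
    then show ?thesis
      using perm by (simp add: h_def mult permute_edges_in_Isom_AT[OF assms] permutes_inv
          compose_permute_edges[OF assms])
  qed
  ultimately have "h \<in> iso (sym_group 3) (Isom_AT A)"
    by (auto simp: iso_def hom_def bij_betw_def sym_group_def)
  then have "sym_group 3 \<cong> Isom_AT A" by (auto simp: is_iso_def)
  then show "Isom_AT A \<cong> sym_group 3" by (rule group.iso_sym[OF sym_group_is_group])
qed

end
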